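(* Let $\Delta'\subset[0,1]^2$ be the open convex quadrilateral with vertices $(0,1/2),(5/24,2/3),(1/2,1),(0,1)$ and $\Delta''\subset[0,1]^2$ the open convex quadrilateral with vertices $(0,1/2),(1/3,19/24),(1/2,1),(0,1)$. Then $\Delta'$ and $\Delta''$ are dimension traps for the baker's map, i.e. $\dim_{\mathrm H}\mathcal J(\Delta')=\dim_{\mathrm H}\mathcal J(\Delta'')=0$.
   Context: Let $X=[0,1]^2$. The baker's map is $B(x,y)=(2x,\frac y2)$ if $0\le x<\frac12$ and $B(x,y)=(2x-1,\frac{y+1}2)$ if $\frac12\le x<1$. For a bi-infinite sequence $u=(x_n)_{n\in\mathbb Z}\in\{0,1\}^{\mathbb Z}$, written $\dots x_{-1}x_0\cdot x_1x_2\dots$, put $\pi(u)=\left(\sum_{n\ge1}x_n2^{-n},\ \sum_{n\ge0}x_{-n}2^{-n-1}\right)$. The map $\pi$ conjugates the left shift $\sigma$ and $B$; points and sequences are used interchangeably, so the $B$-orbit of the point $\pi(u)$ is $(\pi(\sigma^n u))_{n\in\mathbb Z}$. For $H\subset X$ the survivor set is $\mathcal J(H)=\{(x,y)\in X: B^n(x,y)\notin H \text{ for all } n\in\mathbb Z\}$, i.e. $\mathcal J(H)=\{\pi(u): \pi(\sigma^nu)\notin H\ \text{for all } n\in\mathbb Z\}$. An open set $H$ is a dimension trap if $\dim_{\mathrm H}\mathcal J(H)=0$ (Hausdorff dimension). *)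

theory Defs
  imports "HOL-Analysis.Analysis"
begin

section \<open>Hausdorff dimension\<close>

text \<open>The convention is \<open>0\<^sup>0 = 1\<close> for the diameter of a nonempty set, and the empty set
  contributes \<open>0\<close> for every \<open>s\<close>; note that \<open>0 powr 0 = 0\<close> in the library.\<close>

definition diam_pow :: "real \<Rightarrow> 'a::metric_space set \<Rightarrow> ennreal" where
  "diam_pow s U = (if U = {} then 0 else if s = 0 then 1 else ennreal (diameter U powr s))"

text \<open>Boundedness is required because \<^const>\<open>diameter\<close> is only meaningful on bounded sets.
  Finite covers are included, since the \<open>U i\<close> may be empty.\<close>

definition delta_cover :: "real \<Rightarrow> 'a::metric_space set \<Rightarrow> (nat \<Rightarrow> 'a set) \<Rightarrow> bool" where
  "delta_cover \<delta> A U \<longleftrightarrow> A \<subseteq> (\<Union>i. U i) \<and> (\<forall>i. bounded (U i) \<and> diameter (U i) \<le> \<delta>)"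

definition hausdorff_premeasure :: "real \<Rightarrow> real \<Rightarrow> 'a::metric_space set \<Rightarrow> ennreal" where
  "hausdorff_premeasure s \<delta> A = (INF U \<in> {U. delta_cover \<delta> A U}. \<Sum>i. diam_pow s (U i))"

definition hausdorff_measure :: "real \<Rightarrow> 'a::metric_space set \<Rightarrow> ennreal" where
  "hausdorff_measure s A = (SUP \<delta> \<in> {0<..}. hausdorff_premeasure s \<delta> A)"

definition hausdorff_dim :: "'a::metric_space set \<Rightarrow> ennreal" where
  "hausdorff_dim A = Inf {ennreal s | s. 0 \<le> s \<and> hausdorff_measure s A = 0}"

section \<open>The baker's map and its symbolic model\<close>

definition unit_square :: "(real \<times> real) set" where
  "unit_square = {0..1} \<times> {0..1}"

text \<open>The usual formula covers \<open>0 \<le> x < 1\<close>; the second branch is also used at \<open>x = 1\<close>.\<close>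

definition baker :: "real \<times> real \<Rightarrow> real \<times> real" where
  "baker = (\<lambda>(x, y). if x < 1/2 then (2 * x, y / 2) else (2 * x - 1, (y + 1) / 2))"

text \<open>Elements of \<open>{0,1}\<^sup>\<int>\<close> are functions of type \<^typ>\<open>int \<Rightarrow> bool\<close>, with digit
  \<open>of_bool (u n)\<close> at position \<open>n\<close>.\<close>

definition shift :: "int \<Rightarrow> (int \<Rightarrow> bool) \<Rightarrow> (int \<Rightarrow> bool)" where
  "shift n u = (\<lambda>k. u (k + n))"

definition baker_pt :: "(int \<Rightarrow> bool) \<Rightarrow> real \<times> real" where
  "baker_pt u =
     ((\<Sum>n. of_bool (u (int n + 1)) / 2 ^ (n + 1)), (\<Sum>n. of_bool (u (- int n)) / 2 ^ (n + 1)))"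

text \<open>The bi-infinite orbit of a point is read off from a coding sequence. This makes sense of
  negative iterates, and it fixes the meaning of orbits at points with a dyadic coordinate,
  where the coding is not unique.\<close>

definition survivor_set :: "(real \<times> real) set \<Rightarrow> (real \<times> real) set" where
  "survivor_set H = {baker_pt u | u. \<forall>n. baker_pt (shift n u) \<notin> H}"

definition dimension_trap :: "(real \<times> real) set \<Rightarrow> bool" where
  "dimension_trap H \<longleftrightarrow>
     openin (top_of_set unit_square) H \<and> hausdorff_dim (survivor_set H) = 0"

section \<open>Relation between the two descriptions of the dynamics\<close>

lemma summable_digits: "summable (\<lambda>n. of_bool (P n) / 2 ^ (n + 1) :: real)"
proof (rule summable_comparison_test')
  show "summable (\<lambda>n. (1/2) ^ n :: real)"
    by (rule summable_geometric) simp
  show "norm (of_bool (P n) / 2 ^ (n + 1) :: real) \<le> (1/2) ^ n" for n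
    by (auto simp: field_simps)
qed

lemma suminf_half_powers: "(\<Sum>n. 1 / 2 ^ (n + 1) :: real) = 1"
  using power_half_series by (simp add: sums_iff power_divide)

lemma suminf_digits_le: "(\<Sum>n. of_bool (P n) / 2 ^ (n + 1) :: real) \<le> 1"
proof -
  have "(\<Sum>n. of_bool (P n) / 2 ^ (n + 1) :: real) \<le> (\<Sum>n. 1 / 2 ^ (n + 1))"
    using summable_digits[of P] summable_digits[of "\<lambda>_. True"]
    by (intro suminf_le) (auto simp: divide_right_mono)
  then show ?thesis by (simp only: suminf_half_powers)
qed

lemma suminf_digits_less:
  assumes "\<not> P m"
  shows "(\<Sum>n. of_bool (P n) / 2 ^ (n + 1) :: real) < 1"
proof -
  have eq: "1 / 2 ^ (n + 1) - of_bool (P n) / 2 ^ (n + 1) = (of_bool (\<not> P n) / 2 ^ (n + 1) :: real)" for n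
    by simp
  have "0 < (\<Sum>n. of_bool (\<not> P n) / 2 ^ (n + 1) :: real)"
    using summable_digits[of "\<lambda>n. \<not> P n"] assms
    by (intro suminf_pos2[where i = m]) auto
  also have "\<dots> = (\<Sum>n. 1 / 2 ^ (n + 1)) - (\<Sum>n. of_bool (P n) / 2 ^ (n + 1) :: real)"
    using suminf_diff[OF summable_digits[of "\<lambda>_. True"] summable_digits[of P]]
    by (simp only: eq of_bool_eq)
  finally show ?thesis by (simp only: suminf_half_powers)
qed

lemma suminf_digits_split:
  "(\<Sum>n. of_bool (P n) / 2 ^ (n + 1) :: real) =
     of_bool (P 0) / 2 + (\<Sum>n. of_bool (P (Suc n)) / 2 ^ (n + 1)) / 2"
proof -
  have "(\<Sum>n. of_bool (P (Suc n)) / 2 ^ (Suc n + 1) :: real) =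
        (\<Sum>n. of_bool (P (Suc n)) / 2 ^ (n + 1) / 2)"
    by (intro arg_cong[where f = suminf]) (auto simp: fun_eq_iff field_simps)
  also have "\<dots> = (\<Sum>n. of_bool (P (Suc n)) / 2 ^ (n + 1)) / 2"
    by (rule suminf_divide[OF summable_digits])
  finally show ?thesis
    using suminf_split_head[OF summable_digits[of P]] by simp
qed

lemma baker_pt_in_unit_square: "baker_pt u \<in> unit_square"
  unfolding baker_pt_def unit_square_def mem_Times_iff fst_conv snd_conv atLeastAtMost_iff
  by (intro conjI suminf_nonneg summable_digits suminf_digits_le) simp_all

text \<open>The excluded sequences, with \<open>x\<^sub>n = 1\<close> for all \<open>n \<ge> 2\<close>, are the ones for which
  the first coordinate is the non-terminating expansion of \<open>1/2\<close> or of \<open>1\<close>.\<close>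

lemma baker_baker_pt:
  assumes "m \<ge> 2" "\<not> u m"
  shows "baker (baker_pt u) = baker_pt (shift 1 u)"
proof -
  define x where "x = (\<Sum>n. of_bool (u (int n + 2)) / 2 ^ (n + 1) :: real)"
  define y where "y = (\<Sum>n. of_bool (u (- int n)) / 2 ^ (n + 1) :: real)"
  have "\<not> u (int (nat (m - 2)) + 2)" using assms by simp
  then have x1: "x < 1"
    unfolding x_def by (rule suminf_digits_less)
  have x0: "0 \<le> x"
    unfolding x_def by (intro suminf_nonneg summable_digits) simp
  have "(\<lambda>n. u (int (Suc n) + 1)) = (\<lambda>n. u (int n + 2))" by (simp add: add_ac)
  then have 1: "baker_pt u = (of_bool (u 1) / 2 + x / 2, y)"
    unfolding baker_pt_def x_def y_def
    using suminf_digits_split[of "\<lambda>n. u (int n + 1)"] by (simp add: fun_eq_iff)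
  have 2: "baker_pt (shift 1 u) = (x, of_bool (u 1) / 2 + y / 2)"
    unfolding baker_pt_def x_def y_def shift_def
    using suminf_digits_split[of "\<lambda>n. u (- int n + 1)"] by (simp add: add.assoc)
  show ?thesis
    unfolding 1 2 baker_def using x0 x1 by (cases "u 1") (auto simp: field_simps)
qed

end

theory Submission
  imports Defs
begin

text \<open>
  At an occurrence \<open>s1.0t\<close> in a bi-infinite word put \<open>X = 0.t\<close> and \<open>Y = 0.s'\<close> in binary, where
  \<open>s'\<close> is \<open>s\<close> read backwards. The point lies in the first hole iff
  \<open>0 < X\<close>, \<open>Y < 1\<close>, \<open>4/5 X < Y\<close> and \<open>1 - Y < 8/7 (1 - X)\<close>, so avoiding the hole forces \<open>Y < X\<close>, and
  \<open>X > 0.011(01)\<^sup>\<infinity> = 5/12\<close> as soon as \<open>Y > 0.(01)\<^sup>\<infinity> = 1/3\<close>. These two lexicographic conditions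
  imply that once a block \<open>11\<close> has been followed by a block \<open>00\<close>, there is no further \<open>00\<close>. Hence
  a word of the language is, up to boundedly many letters and runs, a product of three words each
  of which omits \<open>11\<close> or omits \<open>00\<close>.

  A word omitting \<open>11\<close> or \<open>00\<close> is the image of a shorter word under \<open>0 \<mapsto> 0, 1 \<mapsto> 01\<close> or
  \<open>0 \<mapsto> 10, 1 \<mapsto> 1\<close>. Both substitutions act in the same way on \<open>X\<close> and on the reversed
  \<open>Y\<close>, preserve the lexicographic order, and any composition of them maps the corner \<open>(5/12, 1/3)\<close>
  of the hole into its closure; so the preimages satisfy the same two conditions and the argument
  can be iterated. After many steps the words are products of two blocks one of which is long,
  so the language has zero entropy, and covering by cylinders gives dimension zero. Reversing and
  complementing words exchanges the two holes.
\<close>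

section \<open>Binary expansions and substitutions\<close>

text \<open>\<open>ext s r\<close> is the number \<open>0.s\<close> in binary, continued by the expansion of \<open>r\<close>.\<close>

fun ext :: "bool list \<Rightarrow> real \<Rightarrow> real" where
  "ext [] r = r"
| "ext (x # s) r = (of_bool x + ext s r) / 2"

lemma ext_append: "ext (p @ q) r = ext p (ext q r)"
  by (induction p) auto

lemma ext_diff: "ext p r - ext p r' = (r - r') / 2 ^ length p"
  by (induction p) (auto simp: field_simps)

lemma ext_mono: "r \<le> r' \<Longrightarrow> ext p r \<le> ext p r'"
  by (induction p) auto

lemma ext_strict_mono: "r < r' \<Longrightarrow> ext p r < ext p r'"
  by (induction p) auto

lemma ext_nonneg: "0 \<le> r \<Longrightarrow> 0 \<le> ext p r"
  by (induction p) auto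

lemma ext_le_1: "r \<le> 1 \<Longrightarrow> ext p r \<le> 1"
  by (induction p) (auto simp: of_bool_def)

lemma ext_pos: "True \<in> set p \<Longrightarrow> 0 \<le> r \<Longrightarrow> 0 < ext p r"
  by (induction p) (auto simp: add_pos_nonneg add_nonneg_pos ext_nonneg)

lemma ext_less_1: "False \<in> set p \<Longrightarrow> r \<le> 1 \<Longrightarrow> ext p r < 1"
proof (induction p)
  case (Cons x p)
  then show ?case using ext_le_1[of r p] by (cases x) auto
qed auto

text \<open>Lexicographic order decided at a letter that is followed by at least \<open>m\<close> known letters on both
  sides; each substitution uses up one of them.\<close>

definition lex_gap :: "nat \<Rightarrow> bool list \<Rightarrow> bool list \<Rightarrow> bool" where
  "lex_gap m p q \<longleftrightarrow>
     (\<exists>c p' q'. p = c @ False # p' \<and> q = c @ True # q' \<and> m \<le> length p' \<and> m \<le> length q')"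

text \<open>After the common prefix, a word starting with 0 is worth at most 1/2 and one starting
  with 1 at least 1/2. Equality occurs for 0111... and 1000..., so the conclusion is weak.\<close>

lemma lex_gap_ext_le:
  assumes "lex_gap m p q" "r \<le> 1" "0 \<le> r'"
  shows "ext p r \<le> ext q r'"
proof -
  obtain c p' q' where *: "p = c @ False # p'" "q = c @ True # q'"
    using assms(1) unfolding lex_gap_def by blast
  have "ext (False # p') r \<le> ext (True # q') r'"
    using ext_le_1[OF assms(2), of p'] ext_nonneg[OF assms(3), of q'] by simp
  then show ?thesis unfolding * ext_append by (rule ext_mono)
qed

text \<open>Strictness comes from first raising the tail of the smaller word to 1.\<close>

lemma lex_gap_ext_less:
  assumes "lex_gap m p q" "r < 1" "0 \<le> r'"
  shows "ext p r < ext q r'"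
  using ext_strict_mono[OF assms(2), of p] lex_gap_ext_le[OF assms(1) order_refl assms(3)] by simp

section \<open>The two substitutions and their effect on contexts and order\<close>

definition sub :: "bool \<Rightarrow> bool list \<Rightarrow> bool list" where
  "sub i z = concat (map (\<lambda>x. if x = i then [i] else [i, x]) z)"

text \<open>The head of the list is the outermost substitution.\<close>

fun subs :: "bool list \<Rightarrow> bool list \<Rightarrow> bool list" where
  "subs [] z = z"
| "subs (i # w) z = sub i (subs w z)"

lemma sub_Nil [simp]: "sub i [] = []"
  and sub_Cons: "sub i (x # z) = (if x = i then [i] else [i, x]) @ sub i z"
  and sub_append: "sub i (y @ z) = sub i y @ sub i z"
  by (auto simp: sub_def)

lemma subs_append: "subs w (y @ z) = subs w y @ subs w z"
  by (induction w) (auto simp: sub_append)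

lemma subs_Nil [simp]: "subs w [] = []"
  by (induction w) auto

lemma subs_snoc: "subs (w @ [i]) z = subs w (sub i z)"
  by (induction w) auto

lemma length_sub: "length z \<le> length (sub i z)"
  by (induction z) (auto simp: sub_Cons)

lemma set_sub: "set z \<subseteq> set (sub i z)"
  by (induction z) (auto simp: sub_Cons)

lemma set_subs: "set z \<subseteq> set (subs w z)"
  by (induction w) (use set_sub in fastforce)+

text \<open>Blocks of \<open>sub i\<close> start with \<open>i\<close>, blocks of its mirror image
  end with \<open>i\<close>; moving one \<open>i\<close> across the word converts one into the
  other. Hence the left context, read backwards, transforms like the right one.\<close>

lemma rev_sub: "i # rev (sub i z) = sub i (rev z) @ [i]"
  by (induction z) (auto simp: sub_Cons sub_append)

text \<open>\<open>sub i\<close> sends \<open>10\<close> to \<open>i10\<close>, so a marked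
  \<open>10\<close> yields a marked \<open>10\<close> in the image. The surplus \<open>p\<close>
  lies at the far end of the left context.\<close>

lemma subs_split:
  "\<exists>l p. subs w (s @ [True, False] @ t) = l @ [True, False] @ subs w t \<and> rev l = subs w (rev s) @ p"
proof (induction w)
  case Nil
  then show ?case by (auto intro: exI[of _ s])
next
  case (Cons i w)
  then obtain l p where
    lp: "subs w (s @ [True, False] @ t) = l @ [True, False] @ subs w t" "rev l = subs w (rev s) @ p"
    by blast
  have "sub i (l @ [True, False] @ subs w t) = (sub i l @ [i]) @ [True, False] @ sub i (subs w t)"
    by (auto simp: sub_append sub_Cons)
  moreover have "rev (sub i l @ [i]) = sub i (subs w (rev s)) @ (sub i p @ [i])"
    using rev_sub[of i l] lp(2) by (simp add: sub_append)
  ultimately show ?case unfolding subs.simps lp(1) by blast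
qed

lemma subs_01_10:
  "\<exists>c. subs w [False, True] = c @ [False, True] \<and> subs w [True, False] = c @ [True, False]"
proof (induction w)
  case (Cons i w)
  then obtain c where
    "subs w [False, True] = c @ [False, True]" "subs w [True, False] = c @ [True, False]" by blast
  then show ?case by (intro exI[of _ "sub i c @ [i]"]) (auto simp: sub_append sub_Cons)
qed auto

text \<open>Of the two differing letters, the one equal to \<open>i\<close> becomes \<open>i\<close>
  alone, and the new difference on that side is the initial \<open>i\<close> of the next block. This
  costs that side one known letter.\<close>

lemma lex_gap_sub:
  assumes "lex_gap (Suc m) p q"
  shows "lex_gap m (sub i p) (sub i q)"
proof -
  obtain c p' q' where *: "p = c @ False # p'" "q = c @ True # q'"
    "Suc m \<le> length p'" "Suc m \<le> length q'"
    using assms unfolding lex_gap_def by blast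
  obtain x p'' y q'' where **: "p' = x # p''" "q' = y # q''"
    using *(3,4) by (cases p'; cases q') auto
  show ?thesis
    unfolding lex_gap_def
    by (rule exI[of _ "sub i c @ [i]"])
      (use *(3,4) length_sub[of p' i] length_sub[of q' i] length_sub[of p'' i] length_sub[of q'' i]
        in \<open>auto simp: * ** sub_append sub_Cons\<close>)
qed

lemma lex_gap_subs: "lex_gap (m + length w) p q \<Longrightarrow> lex_gap m (subs w p) (subs w q)"
proof (induction w arbitrary: m)
  case (Cons i w)
  then show ?case using lex_gap_sub[of m "subs w p" "subs w q" i] Cons.IH[of "Suc m"] by simp
qed auto

section \<open>Periodic words and the image of the corner\<close>

abbreviation pow_word :: "bool list \<Rightarrow> nat \<Rightarrow> bool list" where
  "pow_word z k \<equiv> concat (replicate k z)"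

lemma subs_pow_word: "subs w (pow_word z k) = pow_word (subs w z) k"
  by (induction k) (auto simp: subs_append)

lemma ext_pow_word: "ext z r = r \<Longrightarrow> ext (pow_word z k) r = r"
  by (induction k) (auto simp: ext_append)

text \<open>The images of \<open>01\<close> and \<open>10\<close> end in \<open>01\<close> and \<open>10\<close> and agree otherwise. With \<open>P = 2\<^sup>-\<^sup>l\<close>, where
  \<open>l\<close> is the length of the image of \<open>01\<close>, the image of the corner therefore has \<open>X - Y = P\<^sup>2 / (1 - P)\<close>.\<close>

lemma corner:
  obtains r where "0 < r" "r < 1" "ext (subs w [False, True]) r = r"
    "4/5 * ext (subs w [False, True, True]) r \<le> r"
    "1 - r \<le> 8/7 * (1 - ext (subs w [False, True, True]) r)"
proof -
  obtain c where c: "subs w [False, True] = c @ [False, True]" "subs w [True, False] = c @ [True, False]"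
    using subs_01_10 by blast
  define P :: real where "P = 1 / 2 ^ length c / 4"
  have P: "0 < P" "P \<le> 1/4" by (auto simp: P_def field_simps)
  define ab ba b where "ab = subs w [False, True]" and "ba = subs w [True, False]" and "b = subs w [True]"
  have ab: "ext ab r = ext c (1/4) + P * r" for r
    unfolding ab_def c ext_append using ext_diff[of c "ext [False, True] r" "1/4"]
    by (simp add: P_def field_simps)
  have ba: "ext ba r = ext c (1/4) + P + P * r" for r
    unfolding ba_def c ext_append using ext_diff[of c "ext [True, False] r" "1/4"]
    by (simp add: P_def field_simps)
  have lo: "P \<le> ext c (1/4)"
    using ext_diff[of c "1/4" 0] ext_nonneg[of 0 c] by (simp add: P_def)
  have hi: "ext c (1/4) \<le> 1 - 3 * P"
    using ext_diff[of c 1 "1/4"] ext_le_1[of 1 c] by (simp add: P_def)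
  \<comment> \<open>The fixed point of the affine map \<open>ext ab\<close>, that is, the value of
    the periodic word with period \<open>ab\<close>.\<close>
  define r where "r = ext c (1/4) / (1 - P)"
  have r: "ext ab r = r" using P by (simp add: ab r_def field_simps)
  \<comment> \<open>Both sides read the image of \<open>101\<close>, so \<open>ext b r\<close> is
    the fixed point of \<open>ext ba\<close>.\<close>
  have "ext ba (ext b r) = ext b (ext ab r)"
    unfolding ab_def ba_def b_def ext_append[symmetric] subs_append[symmetric] by simp
  then have "ext b r = (ext c (1/4) + P) / (1 - P)"
    using r P by (simp add: ba field_simps)
  moreover have "ext (subs w [False, True, True]) r = ext ab (ext b r)"
    unfolding ab_def b_def ext_append[symmetric] subs_append[symmetric] by simp
  ultimately have X: "ext (subs w [False, True, True]) r = r + P * (P / (1 - P))"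
    using r P by (simp add: ab add_divide_distrib r_def[symmetric] algebra_simps)
  have PP: "P * P \<le> P / 4" using P by (simp add: field_simps)
  have sc: "r * (1 - P) = ext c (1/4)" "P * (P / (1 - P)) * (1 - P) = P * P"
    using P by (auto simp: r_def)
  show ?thesis
  proof (rule that[of r])
    show "0 < r" "r < 1" using P lo hi by (auto simp: r_def field_simps)
    show "ext (subs w [False, True]) r = r" using r by (simp add: ab_def)
    \<comment> \<open>Multiplied by \<open>1 - P\<close>, both corner inequalities follow from
      \<open>P \<le> 1/4\<close> with \<open>lo\<close> and \<open>hi\<close>; for empty
      \<open>w\<close> they are equalities.\<close>
    have "4 * (P * (P / (1 - P))) * (1 - P) \<le> r * (1 - P)" using sc PP lo by linarith
    then have "4 * (P * (P / (1 - P))) \<le> r" using P by (subst (asm) mult_le_cancel_right_pos) auto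
    then show "4/5 * ext (subs w [False, True, True]) r \<le> r" unfolding X by simp
    have "8 * (P * (P / (1 - P))) * (1 - P) \<le> (1 - r) * (1 - P)"
    proof -
      have "8 * (P * (P / (1 - P))) * (1 - P) = 8 * (P * P)" by (metis mult.assoc sc(2))
      moreover have "(1 - r) * (1 - P) = 1 - P - r * (1 - P)" by (simp add: algebra_simps)
      ultimately show ?thesis using sc(1) PP hi by linarith
    qed
    then have "8 * (P * (P / (1 - P))) \<le> 1 - r" using P by (subst (asm) mult_le_cancel_right_pos) auto
    then show "1 - r \<le> 8/7 * (1 - ext (subs w [False, True, True]) r)" unfolding X by simp
  qed
qed

section \<open>Words satisfying the lexicographic conditions\<close>

abbreviation no_pair :: "bool \<Rightarrow> bool list \<Rightarrow> bool" where
  "no_pair x \<equiv> successively (\<lambda>a b. \<not> (a = x \<and> b = x))"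

lemma first_pair:
  assumes "\<not> no_pair x z"
  obtains p q where "z = p @ [x, x] @ q" "no_pair x (p @ [x])"
proof -
  have "\<exists>p q. z = p @ [x, x] @ q \<and> no_pair x (p @ [x])"
    using assms
  proof (induction z)
    case (Cons a z)
    show ?case
    proof (cases "a = x \<and> z \<noteq> [] \<and> hd z = x")
      case True
      then show ?thesis by (intro exI[of _ "[]"] exI[of _ "tl z"]) (cases z; auto)
    next
      case False
      then obtain p q where pq: "z = p @ [x, x] @ q" "no_pair x (p @ [x])"
        using Cons by (auto simp: successively_Cons)
      then show ?thesis
        using False by (intro exI[of _ "a # p"] exI[of _ q]) (cases p; auto)
    qed
  qed simp
  then show ?thesis using that by blast
qed

lemma no_pair_rev [simp]: "no_pair x (rev z) \<longleftrightarrow> no_pair x z"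
  unfolding successively_rev by (rule arg_cong[of _ _ "\<lambda>P. successively P z"]) auto

lemma last_pair:
  assumes "\<not> no_pair x z"
  obtains p q where "z = p @ [x, x] @ q" "no_pair x (x # q)"
proof -
  have "\<not> no_pair x (rev z)"
    using assms by (simp only: no_pair_rev not_False_eq_True)
  then obtain p q where pq: "rev z = p @ [x, x] @ q" "no_pair x (p @ [x])"
    using first_pair by blast
  have "z = rev q @ [x, x] @ rev p"
    using arg_cong[OF pq(1), of rev] by simp
  moreover have "no_pair x (x # rev p)"
    using pq(2) no_pair_rev[of x "p @ [x]"] by simp
  ultimately show ?thesis using that by blast
qed

lemma pow_word_add: "pow_word z (a + b) = pow_word z a @ pow_word z b"
  by (simp add: replicate_add)

lemma pow_word_Suc_right: "pow_word z (Suc a) = pow_word z a @ z"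
  using pow_word_add[of a 1 z] by simp

lemma rev_pow_word: "rev (pow_word z k) = pow_word (rev z) k"
  by (simp add: rev_concat)

lemma pow_word_rotate: "y @ pow_word (z @ y) k = pow_word (y @ z) k @ y"
  by (induction k) auto

lemma alternating:
  assumes "no_pair True z" "no_pair False z" "z \<noteq> []" "hd z"
  shows "\<exists>i. z = pow_word [True, False] i @ [True] \<or> z = pow_word [True, False] (Suc i)"
  using assms
proof (induction z rule: induct_list012)
  case (3 x y zs)
  then have xy: "x" "\<not> y" by auto
  show ?case
  proof (cases "zs = []")
    case True
    then show ?thesis using xy by (intro exI[of _ 0]) auto
  next
    case False
    then obtain i where "zs = pow_word [True, False] i @ [True] \<or> zs = pow_word [True, False] (Suc i)"
      using 3 xy by (auto simp: successively_Cons)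
    then show ?thesis using xy by (intro exI[of _ "Suc i"]) auto
  qed
qed (auto intro: exI[of _ 0])

text \<open>From the second letter of the last \<open>11\<close> on, neither pair occurs, so the
  word alternates, and it ends in 0.\<close>

lemma last_block:
  assumes "\<not> no_pair True v" "no_pair False (v @ [False])"
  obtains p m where "v @ [False] = p @ [True] @ pow_word [True, False] (Suc m)"
proof -
  obtain p q where pq: "v = p @ [True, True] @ q" "no_pair True (True # q)"
    using last_pair[OF assms(1)] by blast
  have "no_pair True (True # q @ [False])" "no_pair False (True # q @ [False])"
    using pq assms(2) by (cases q; auto simp: successively_append_iff successively_Cons)+
  then obtain i where "True # q @ [False] = pow_word [True, False] i @ [True] \<or>
      True # q @ [False] = pow_word [True, False] (Suc i)"
    using alternating[of "True # q @ [False]"] by auto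
  then have "True # q @ [False] = pow_word [True, False] (Suc i)"
    by (metis append_Cons last_snoc)
  then show ?thesis using that[of p i] pq(1) by simp
qed

text \<open>\<open>pow_word [False, True] k\<close>, for arbitrary \<open>k\<close>, stands in for \<open>(01)\<^sup>\<infinity>\<close>.\<close>

definition good :: "nat \<Rightarrow> bool list \<Rightarrow> bool" where
  "good K z \<longleftrightarrow> (\<forall>s t. z = s @ [True, False] @ t \<longrightarrow> \<not> lex_gap K t (rev s) \<and>
     (\<forall>k l. \<not> (lex_gap K (pow_word [False, True] k) (rev s) \<and>
              lex_gap K t ([False, True, True] @ pow_word [False, True] l))))"

lemma goodD:
  assumes "good K z" "z = s @ [True, False] @ t"
  shows "\<not> lex_gap K t (rev s)"
    "lex_gap K (pow_word [False, True] k) (rev s) \<Longrightarrow>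
      \<not> lex_gap K t ([False, True, True] @ pow_word [False, True] l)"
  using assms unfolding good_def by blast+

section \<open>Forbidden patterns and the decomposition into three pieces\<close>

lemma lex_gapI:
  "p = c @ False # p' \<Longrightarrow> q = c @ True # q' \<Longrightarrow> m \<le> length p' \<Longrightarrow> m \<le> length q' \<Longrightarrow> lex_gap m p q"
  unfolding lex_gap_def by blast

text \<open>Cut at the first \<open>10\<close> of the last run. Then \<open>t\<close> starts with
  \<open>(10)^m 0\<close> and \<open>rev s\<close> with \<open>(10)^i 11\<close>; whichever of
  \<open>i\<close> and \<open>m\<close> is smaller, \<open>t\<close> is smaller at the first
  difference.\<close>

lemma good_no_110:
  assumes "good K (p @ [True] @ pow_word [True, False] i @ [True] @ pow_word [True, False] (Suc m) @ [False] @ q)"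
    and "K \<le> length p" "K \<le> length q"
  shows False
proof -
  define s t where "s = p @ [True] @ pow_word [True, False] i @ [True]"
    and "t = pow_word [True, False] m @ [False] @ q"
  have "\<not> lex_gap K t (rev s)"
    by (rule goodD(1)[OF assms(1)]) (simp add: s_def t_def)
  moreover have rs: "rev s = pow_word [True, False] i @ [True, True] @ rev p"
    using pow_word_rotate[of "[True]" i "[False]"] by (simp add: s_def rev_pow_word)
  moreover have "lex_gap K t (pow_word [True, False] i @ [True, True] @ rev p)"
  proof (cases "i < m")
    case True
    then have "pow_word [True, False] m = pow_word [True, False] i @ pow_word [True, False] (Suc (m - i - 1))"
      by (subst pow_word_add[symmetric]) simp
    then show ?thesis
      unfolding t_def
      by (intro lex_gapI[where c = "pow_word [True, False] i @ [True]" and q' = "rev p"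
            and p' = "pow_word [True, False] (m - i - 1) @ [False] @ q"]) (use assms in auto)
  next
    case False
    then have "pow_word [True, False] i = pow_word [True, False] m @ pow_word [True, False] (i - m)"
      by (subst pow_word_add[symmetric]) simp
    then show ?thesis
      unfolding t_def
      by (intro lex_gapI[where c = "pow_word [True, False] m" and p' = q
            and q' = "tl (pow_word [True, False] (i - m) @ [True, True] @ rev p)"])
        (use assms in \<open>cases "i - m"; auto\<close>)+
  qed
  ultimately show False by simp
qed

text \<open>Between the last two occurrences of \<open>11\<close> in \<open>v\<close>, which may
  overlap as in \<open>111\<close>, and after the last one, the word alternates. This is the pattern
  excluded by \<open>good_no_110\<close>.\<close>

lemma good_no_late_00:
  assumes "good K (p @ v @ [False, False] @ q)" "K \<le> length p" "K \<le> length q"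
    and v: "v = True # v'" "hd v'" "\<not> no_pair True v'" "no_pair False (v @ [False])"
  shows False
proof -
  have "\<not> no_pair True v" using v by (auto simp: successively_Cons)
  then obtain a b where ab: "v = a @ [True, True] @ b" "no_pair True (True # b)"
    using last_pair by blast
  have "a \<noteq> []" using ab v(1,3) by auto
  then obtain a' where a': "a = True # a'" using ab(1) v(1) by (cases a) auto
  have "\<not> no_pair True (a @ [True])"
    using ab(1) v(1,2) a' by (cases a') (auto simp: successively_Cons)
  then obtain c d where cd: "a @ [True] = c @ [True, True] @ d" "no_pair True (True # d)"
    using last_pair by blast
  have eq: "v @ [False] = c @ [True] @ (True # d) @ (True # b @ [False])"
    using ab(1) cd(1) by simp
  have nF: "no_pair False (True # d)" "no_pair False (True # b @ [False])"
    using v(4) unfolding eq successively_append_iff by blast+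
  have lastd: "last (True # d) = True"
    using arg_cong[OF cd(1), of last] by auto
  obtain i where "True # d = pow_word [True, False] i @ [True] \<or> True # d = pow_word [True, False] (Suc i)"
    using alternating[of "True # d"] cd(2) nF(1) by auto
  then have i: "True # d = pow_word [True, False] i @ [True]"
    using lastd pow_word_Suc_right[of i "[True, False]"] by (metis last_appendR last.simps list.distinct(1))
  have "no_pair True (True # b @ [False])"
    using ab(2) by (cases b) (auto simp: successively_append_iff successively_Cons)
  then obtain m where "True # b @ [False] = pow_word [True, False] m @ [True] \<or>
      True # b @ [False] = pow_word [True, False] (Suc m)"
    using alternating[of "True # b @ [False]"] nF(2) by auto
  then have m: "True # b @ [False] = pow_word [True, False] (Suc m)"
    by (metis append_Cons last_snoc)
  have "p @ v @ [False, False] @ q =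
      (p @ c) @ [True] @ pow_word [True, False] i @ [True] @ pow_word [True, False] (Suc m) @ [False] @ q"
    using arg_cong[OF eq, of "\<lambda>x. p @ x @ [False] @ q"] unfolding i m by simp
  then show False using good_no_110 assms(1-3) by (metis length_append trans_le_add1)
qed

lemma prefix_or_differ:
  "length a \<le> length b \<Longrightarrow>
     (\<exists>b'. b = a @ b') \<or> (\<exists>c x a' b'. a = c @ x # a' \<and> b = c @ (\<not> x) # b')"
proof (induction a arbitrary: b)
  case (Cons y a)
  then obtain z b1 where b: "b = z # b1" by (cases b) auto
  show ?case
  proof (cases "z = y")
    case True
    from Cons b consider b' where "b1 = a @ b'" |
      c x a' b' where "a = c @ x # a'" "b1 = c @ (\<not> x) # b'" by auto metis
    then show ?thesis
    proof cases
      case 2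
      then have "y # a = (y # c) @ x # a' \<and> b = (y # c) @ (\<not> x) # b'" using b True by simp
      then show ?thesis by blast
    qed (use b True in auto)
  next
    case False
    then have "y # a = [] @ y # a \<and> b = [] @ (\<not> y) # b1" using b by auto
    then show ?thesis by blast
  qed
qed simp

lemma before_False_pow_word:
  "c @ False # b = pow_word [False, True] k \<Longrightarrow> \<exists>j. c = pow_word [False, True] j"
proof (induction k arbitrary: c)
  case (Suc k)
  show ?case
  proof (cases "c = []")
    case True
    then show ?thesis by (intro exI[of _ 0]) auto
  next
    case False
    then obtain c' where c': "c = [False, True] @ c'"
      using Suc.prems by (auto simp: Cons_eq_append_conv append_eq_Cons_conv)
    then have "c' @ False # b = pow_word [False, True] k" using Suc.prems by simp
    then obtain j where "c' = pow_word [False, True] j" using Suc.IH by blast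
    then show ?thesis using c' by (intro exI[of _ "Suc j"]) auto
  qed
qed simp

lemma no_pair_pow_word: "no_pair x (True # pow_word [False, True] k)"
proof (induction k)
  case (Suc k)
  then show ?case by (auto simp: successively_Cons)
qed simp

text \<open>\<open>n0\<close> stops before the first \<open>11\<close>, and \<open>n1\<close> runs
  through the first 0 of the next \<open>00\<close>. If \<open>n2\<close> contained
  \<open>00\<close>, compare it with \<open>011(01)(01)...\<close>: smaller violates the second
  condition of \<open>good\<close>, larger forces two occurrences of \<open>11\<close> before the
  next \<open>00\<close>.\<close>

lemma good_decomp:
  assumes good: "good K (m1 @ y @ m2)" and K: "K \<le> length m1" "K \<le> length m2"
  obtains n0 n1 n2 where "y = n0 @ n1 @ n2" "no_pair True n0" "no_pair False n1" "no_pair False n2"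
proof (cases "no_pair True y")
  case True
  then show ?thesis using that[of y "[]" "[]"] by simp
next
  case False
  then obtain p q0 where p: "y = p @ [True, True] @ q0" "no_pair True (p @ [True])"
    using first_pair by blast
  then have p': "no_pair True p" by (simp add: successively_append_iff)
  show ?thesis
  proof (cases "no_pair False ([True, True] @ q0)")
    case True
    then show ?thesis using that[of p "[True, True] @ q0" "[]"] p p' by simp
  next
    case False
    then obtain v q1 where v: "[True, True] @ q0 = v @ [False, False] @ q1" "no_pair False (v @ [False])"
      using first_pair by blast
    obtain v' where v': "v = True # True # v'"
      using v(1) by (cases v; cases "tl v") auto
    have "\<not> no_pair True v" by (simp add: v' successively_Cons)
    then obtain a m where am: "v @ [False] = a @ [True] @ pow_word [True, False] (Suc m)"
      using last_block v(2) by blast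
    \<comment> \<open>The marked \<open>10\<close> is the last period of \<open>v @ [False]\<close>,
      so \<open>rev s\<close> starts with \<open>(01)^m 1\<close> and exceeds the periodic
      word.\<close>
    define s where "s = m1 @ p @ a @ [True] @ pow_word [True, False] m"
    have z: "m1 @ y @ m2 = s @ [True, False] @ (False # q1 @ m2)"
      using arg_cong[OF am, of "\<lambda>x. m1 @ p @ x @ (False # q1 @ m2)"] p(1) v(1) pow_word_Suc_right[of m "[True, False]"]
      by (simp add: s_def)
    have rs: "rev s = pow_word [False, True] m @ [True] @ rev (m1 @ p @ a)"
      by (simp add: s_def rev_pow_word)
    have "pow_word [False, True] (m + Suc K) = pow_word [False, True] m @ False # True # pow_word [False, True] K"
      by (subst pow_word_add) simp
    then have "lex_gap K (pow_word [False, True] (m + Suc K)) (rev s)"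
      by (rule lex_gapI[where c = "pow_word [False, True] m" and p' = "True # pow_word [False, True] K"
            and q' = "rev (m1 @ p @ a)"])
        (use K in \<open>auto simp: rs length_concat sum_list_replicate\<close>)
    then have E: "\<not> lex_gap K (False # q1 @ m2) ([False, True, True] @ pow_word [False, True] l)" for l
      using good z unfolding good_def by blast
    have "no_pair False (False # q1)"
    proof (rule ccontr)
      assume "\<not> no_pair False (False # q1)"
      \<comment> \<open>Large enough that at least \<open>K\<close> letters of
        \<open>\<theta>\<close> follow any position inside \<open>False # q1\<close>.\<close>
      define N where "N = Suc (length q1) + Suc K"
      define \<theta> where "\<theta> = [False, True, True] @ pow_word [False, True] N"
      have len: "length \<theta> = 3 + 2 * N" by (simp add: \<theta>_def length_concat sum_list_replicate)
      have n\<theta>: "no_pair False \<theta>"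
        using no_pair_pow_word[of False N] by (simp add: \<theta>_def successively_Cons)
      consider b' where "\<theta> = (False # q1) @ b'" |
        c x a' b' where "False # q1 = c @ x # a'" "\<theta> = c @ (\<not> x) # b'"
        using prefix_or_differ[of "False # q1" \<theta>] len by (auto simp: N_def)
      then show False
      proof cases
        case 1
        then show ?thesis
          using \<open>\<not> no_pair False (False # q1)\<close> n\<theta> by (metis successively_append_iff)
      next
        case (2 c x a' b')
        have "length c + 1 + length b' = 3 + 2 * N" "length c \<le> length q1"
          using arg_cong[OF 2(2), of length] arg_cong[OF 2(1), of length] len by auto
        then have b': "K \<le> length b'" by (simp add: N_def)
        show False
        proof (cases x)
          case False
          then have "lex_gap K (False # q1 @ m2) \<theta>"
            by (intro lex_gapI[where c = c and p' = "a' @ m2" and q' = b'])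
              (use 2 b' K arg_cong[OF 2(1), of "\<lambda>x. x @ m2"] in auto)
          then show False using E \<theta>_def by simp
        next
          case True
          \<comment> \<open>At the first difference \<open>\<theta>\<close> has a 0. Both words
            start with 0, so this one lies in the periodic part.\<close>
          then obtain c' where "c = [False, True, True] @ c'"
            using 2 unfolding \<theta>_def by (cases c; cases "tl c"; cases "tl (tl c)") auto
          moreover from this obtain j where "c' = pow_word [False, True] j"
            using before_False_pow_word[of c' b' N] 2(2) True by (auto simp: \<theta>_def)
          ultimately have q1: "False # q1 = [False, True] @ ([True] @ pow_word [False, True] j @ [True]) @ a'"
            using 2(1) True by simp
          define h where "h = [True] @ [True] @ pow_word [False, True] j @ [True]"
          have h: "no_pair False h"
            using no_pair_pow_word[of False j]
            by (auto simp: h_def successively_Cons successively_append_iff)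
          have "\<not> no_pair False (h @ a')"
            using \<open>\<not> no_pair False (False # q1)\<close> unfolding q1 h_def by (simp add: successively_Cons)
          then obtain u d where u: "h @ a' = u @ [False, False] @ d" "no_pair False (u @ [False])"
            using first_pair by blast
          \<comment> \<open>\<open>h\<close> omits \<open>00\<close> and ends in 1, so the next
            \<open>00\<close> starts after it.\<close>
          have "\<exists>g. u = h @ g"
          proof (rule ccontr)
            assume *: "\<nexists>g. u = h @ g"
            then obtain g where g: "h = u @ g" "g @ a' = [False, False] @ d"
              using u(1) by (auto simp: append_eq_append_conv2)
            have "g \<noteq> []" using * g(1) by auto
            moreover have "g \<noteq> [False]" using g(1) by (auto simp: h_def append_eq_Cons_conv Cons_eq_append_conv dest: arg_cong[of _ _ last])
            ultimately obtain g' where "g = [False, False] @ g'"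
              using g(2) by (cases g; cases "tl g") auto
            then show False using h g(1) by (simp add: successively_append_iff)
          qed
          then obtain g where g: "u = h @ g" by blast
          \<comment> \<open>In this form \<open>h\<close> visibly starts with \<open>11\<close>
            while its tail still contains \<open>11\<close>.\<close>
          have h': "h = True # pow_word [True, False] j @ [True, True]"
            using pow_word_rotate[of "[True]" j "[False]"] by (simp add: h_def)
          have "m1 @ y @ m2 = (m1 @ p @ v @ [False, False]) @ u @ [False, False] @ (d @ m2)"
            using p(1) v(1) q1 u(1) by (auto simp: h_def)
          then have "good K ((m1 @ p @ v @ [False, False]) @ u @ [False, False] @ (d @ m2))"
            using good by simp
          moreover have "K \<le> length (m1 @ p @ v @ [False, False])" "K \<le> length (d @ m2)"
            using K by auto
          moreover have "u = True # (pow_word [True, False] j @ [True, True] @ g)"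
            using g h' by simp
          moreover have "hd (pow_word [True, False] j @ [True, True] @ g)"
            by (cases j) auto
          moreover have "\<not> no_pair True (pow_word [True, False] j @ [True, True] @ g)"
            by (simp add: successively_append_iff)
          ultimately show False
            using u(2) by (rule good_no_late_00)
        qed
      qed
    qed
    then show ?thesis using that[of p "v @ [False]" "False # q1"] p p' v by simp
  qed
qed

section \<open>Growth of the language\<close>

definition wordcat :: "'a list set \<Rightarrow> 'a list set \<Rightarrow> 'a list set" (infixr "\<odot>" 70) where
  "A \<odot> B = (\<lambda>(a, b). a @ b) ` (A \<times> B)"

lemma wordcatI: "a \<in> A \<Longrightarrow> b \<in> B \<Longrightarrow> a @ b \<in> A \<odot> B"
  unfolding wordcat_def by auto

text \<open>A subset on which \<open>g\<close> is injective already has the full image. Words with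
  several factorizations are thus harmless.\<close>

lemma summable_on_image_nonneg:
  fixes f :: "'b \<Rightarrow> real"
  assumes "(\<lambda>x. f (g x)) summable_on A"
  shows "f summable_on g ` A"
proof -
  obtain U where U: "U \<subseteq> A" "inj_on g U" "g ` A = g ` U"
    using subset_image_inj[of "g ` A" g A] by auto
  have "(f \<circ> g) summable_on U"
    using summable_on_subset_banach[OF assms U(1)] by (simp add: o_def)
  then show ?thesis using U by (simp add: summable_on_reindex)
qed

lemma summable_on_wordcat:
  fixes f :: "'a list \<Rightarrow> real"
  assumes mult: "\<And>a b. f (a @ b) = f a * f b" and nonneg: "\<And>a. 0 \<le> f a"
    and A: "f summable_on A" and B: "f summable_on B"
  shows "f summable_on A \<odot> B"
proof -
  have "(\<lambda>(a, b). f a * f b) summable_on A \<times> B"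
  proof (rule summable_on_SigmaI)
    show "((\<lambda>b. case (a, b) of (a, b) \<Rightarrow> f a * f b) has_sum f a * infsum f B) B" for a
      using has_sum_cmult_right[OF has_sum_infsum[OF B]] by simp
    show "(\<lambda>a. f a * infsum f B) summable_on A"
      by (rule summable_on_cmult_left[OF A])
    show "0 \<le> (case (a, b) of (a, b) \<Rightarrow> f a * f b)" for a b
      using nonneg by simp
  qed
  then show ?thesis
    unfolding wordcat_def
    by (intro summable_on_image_nonneg) (simp add: case_prod_unfold mult)
qed

text \<open>Every \<open>\<not> i\<close> that is not the first letter follows an \<open>i\<close>
  and forms a block with it; \<open>p\<close> holds the exceptional first letter.\<close>

lemma sub_if_no_pair:
  assumes "no_pair (\<not> i) z"
  obtains p y where "z = p @ sub i y" "p \<in> {[], [\<not> i]}"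
proof -
  have *: "\<exists>y. z = (if z \<noteq> [] \<and> hd z = (\<not> i) then [\<not> i] else []) @ sub i y"
    using assms
  proof (induction z rule: induct_list012)
    case 1
    then show ?case by (intro exI[of _ "[]"]) simp
  next
    case (2 x)
    then show ?case by (intro exI[of _ "if x = i then [i] else []"]) (auto simp: sub_Cons)
  next
    case (3 x y zs)
    then obtain u where u: "y # zs = (if y = (\<not> i) then [\<not> i] else []) @ sub i u"
      by auto
    show ?case
    proof (cases "x = i")
      case True
      then show ?thesis using u
        by (cases "y = i"; intro exI[of _ "if y = i then i # u else (\<not> i) # u"]) (auto simp: sub_Cons)
    next
      case False
      then have "y = i" using 3 by auto
      then show ?thesis using u False by (intro exI[of _ u]) auto
    qed
  qed
  then obtain y where "z = (if z \<noteq> [] \<and> hd z = (\<not> i) then [\<not> i] else []) @ sub i y" by blast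
  then show ?thesis by (rule that) simp
qed

section \<open>Weights of words measured after substitution\<close>

definition weight :: "real \<Rightarrow> bool list \<Rightarrow> bool list \<Rightarrow> real" where
  "weight x w z = x ^ length (subs w z)"

lemma weight_append: "weight x w (a @ b) = weight x w a * weight x w b"
  by (simp add: weight_def subs_append power_add)

lemma weight_nonneg: "0 < x \<Longrightarrow> 0 \<le> weight x w z"
  by (simp add: weight_def)

lemma sum_weight_length:
  "(\<Sum>z | length z = n. weight x w z) = (weight x w [False] + weight x w [True]) ^ n"
proof (induction n)
  case 0
  then show ?case by (simp add: weight_def)
next
  case (Suc n)
  have "bij_betw (\<lambda>(a, z). a # z) (UNIV \<times> {z. length z = n}) {z::bool list. length z = Suc n}"
    by (auto simp: bij_betw_def inj_on_def length_Suc_conv image_def)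
  then have "(\<Sum>z | length z = Suc n. weight x w z) =
      (\<Sum>(a, z)\<in>UNIV \<times> {z. length z = n}. weight x w (a # z))"
    by (subst sum.reindex_bij_betw[symmetric]) (auto simp: case_prod_unfold)
  also have "\<dots> = (\<Sum>(a, z)\<in>UNIV \<times> {z. length z = n}. weight x w [a] * weight x w z)"
    by (intro sum.cong refl) (auto simp: weight_append[symmetric])
  also have "\<dots> = (\<Sum>a\<in>UNIV. weight x w [a]) * (\<Sum>z | length z = n. weight x w z)"
    by (simp add: sum.cartesian_product[symmetric] sum_product)
  finally show ?case by (simp add: Suc UNIV_bool algebra_simps)
qed

text \<open>\<open>sub i\<close> adds one letter per \<open>\<not> i\<close>, and the image of the
  letter \<open>\<not> i\<close> contains \<open>\<not> i\<close>. So each substitution lengthens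
  the image of at least one letter.\<close>

lemma length_subs_pos: "1 \<le> length (subs w [x])"
  and length_subs_letters: "length w + 2 \<le> length (subs w [False]) + length (subs w [True])"
proof -
  have *: "length (sub i z) = length z + count_list z (\<not> i)" for i z
    by (induction z) (auto simp: sub_Cons)
  have c: "1 \<le> count_list (subs w [x]) x" for w x
  proof (induction w)
    case (Cons i w)
    have "count_list z x \<le> count_list (sub i z) x" for z
      by (induction z) (auto simp: sub_Cons)
    then show ?case using Cons by (auto intro: order_trans)
  qed auto
  show "length w + 2 \<le> length (subs w [False]) + length (subs w [True])"
  proof (induction w)
    case (Cons i w)
    show ?case using Cons c[of w True] c[of w False] by (cases i) (auto simp: *)
  qed auto
  show "1 \<le> length (subs w [x])"
    using c[of w x] count_le_length[of "subs w [x]" x] by linarith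
qed

text \<open>One letter image has length at least \<open>n\<close>, so all words of length
  \<open>k\<close> together weigh at most \<open>(x + x ^ n) ^ k\<close>, and the geometric series
  converges.\<close>

lemma summable_weight_deep:
  assumes x: "0 < x" "x < 1" "x + x ^ n < 1" and w: "2 * n \<le> length w"
  shows "weight x w summable_on A"
proof -
  define \<rho> where "\<rho> = weight x w [False] + weight x w [True]"
  have le: "weight x w [a] \<le> x ^ k" if "k \<le> length (subs w [a])" for a k
    unfolding weight_def using x that by (intro power_decreasing) auto
  have nn: "0 \<le> weight x w z" for z using x by (simp add: weight_nonneg)
  have "n \<le> length (subs w [False]) \<or> n \<le> length (subs w [True])"
    using length_subs_letters[of w] w by linarith
  then have "\<rho> \<le> x + x ^ n"
  proof
    assume "n \<le> length (subs w [False])"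
    then show ?thesis using le[of n False] le[of 1 True] length_subs_pos[of w True] by (simp add: \<rho>_def)
  next
    assume "n \<le> length (subs w [True])"
    then show ?thesis using le[of n True] le[of 1 False] length_subs_pos[of w False] by (simp add: \<rho>_def)
  qed
  then have "\<rho> < 1" using x(3) by simp
  have "0 \<le> \<rho>" using nn by (simp add: \<rho>_def)
  have "sum (weight x w) F \<le> 1 / (1 - \<rho>)" if F: "finite F" for F
  proof -
    define N where "N = Suc (Max (insert 0 (length ` F)))"
    have sub: "F \<subseteq> (\<Union>k<N. {z. length z = k})"
      using F by (auto simp: N_def less_Suc_eq_le)
    have fin: "finite {z::bool list. length z = k}" for k
      using finite_lists_length_eq[of "UNIV :: bool set" k] by simp
    have "sum (weight x w) F \<le> sum (weight x w) (\<Union>k<N. {z. length z = k})"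
      using fin nn by (intro sum_mono2 sub) auto
    also have "\<dots> = (\<Sum>k<N. \<rho> ^ k)"
      using fin by (subst sum.UNION_disjoint) (auto simp: sum_weight_length \<rho>_def)
    also have "\<dots> \<le> 1 / (1 - \<rho>)"
      using \<open>\<rho> < 1\<close> \<open>0 \<le> \<rho>\<close> by (simp add: sum_gp_strict divide_right_mono)
    finally show ?thesis .
  qed
  then show ?thesis
    using nn by (intro nonneg_bdd_above_summable_on) (auto simp: bdd_above_def)
qed

text \<open>\<open>r\<close> and \<open>r'\<close> are the unknown continuations to the right and to
  the left. The letters required in \<open>s\<close> and \<open>t\<close> give Y < 1 and X > 0,
  leaving the two slanted sides; 4/5 and 8/7 are the slopes from the corner (5/12, 1/3) to (0, 0)
  and (1, 1).\<close>

locale wedge_language =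
  fixes L :: "bool list set"
  assumes factor: "a @ z @ b \<in> L \<Longrightarrow> z \<in> L"
    and avoids: "s @ [True, False] @ t \<in> L \<Longrightarrow> False \<in> set s \<Longrightarrow> True \<in> set t \<Longrightarrow>
      \<exists>r\<in>{0..1}. \<exists>r'\<in>{0..1}. \<not> (4/5 * ext t r < ext (rev s) r' \<and>
        1 - ext (rev s) r' < 8/7 * (1 - ext t r))"
begin

section \<open>Preimages of the language under substitutions\<close>

definition pre :: "bool list \<Rightarrow> bool list set" where
  "pre w = {z. subs w z \<in> L}"

lemma pre_factor: "a @ z @ b \<in> pre w \<Longrightarrow> z \<in> pre w"
  unfolding pre_def by (auto simp: subs_append intro: factor)

text \<open>The surplus \<open>p\<close> from \<open>subs_split\<close> is absorbed into the
  continuation as \<open>ext p r'\<close>.\<close>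

lemma pre_avoids:
  assumes "s @ [True, False] @ t \<in> pre w" "False \<in> set s" "True \<in> set t"
  obtains r r' where "r \<in> {0..1}" "r' \<in> {0..1}"
    "\<not> (4/5 * ext (subs w t) r < ext (subs w (rev s)) r' \<and>
        1 - ext (subs w (rev s)) r' < 8/7 * (1 - ext (subs w t) r))"
proof -
  obtain l p where l: "subs w (s @ [True, False] @ t) = l @ [True, False] @ subs w t"
    "rev l = subs w (rev s) @ p"
    using subs_split by blast
  have "False \<in> set (rev l)" using assms(2) set_subs[of "rev s" w] by (auto simp: l(2))
  moreover have "True \<in> set (subs w t)" using assms(3) set_subs by blast
  ultimately obtain r r' where r: "r \<in> {0..1}" "r' \<in> {0..1}"
    "\<not> (4/5 * ext (subs w t) r < ext (rev l) r' \<and> 1 - ext (rev l) r' < 8/7 * (1 - ext (subs w t) r))"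
    using avoids[of l "subs w t"] assms(1) l(1) unfolding pre_def by auto
  then show ?thesis
    using that[of r "ext p r'"] by (simp add: l(2) ext_append ext_nonneg ext_le_1)
qed

text \<open>The substitutions in \<open>w\<close> use up the gap \<open>length w\<close>. Violating
  the first condition gives X \<le> Y, with X > 0 and Y < 1 from the end letters; violating the
  second puts the point strictly above and weakly left of the corner. Either point is in the
  wedge.\<close>

lemma pre_good:
  assumes "z \<in> pre w" "z \<noteq> []" "hd z = False" "last z = True"
  shows "good (length w) z"
  unfolding good_def
proof (intro allI impI conjI)
  fix s t assume z: "z = s @ [True, False] @ t"
  have s: "False \<in> set s" using z assms(3) by (cases s) auto
  have t: "True \<in> set t" using z assms(4) by (cases t rule: rev_cases) auto
  obtain r r' where r: "r \<in> {0..1}" "r' \<in> {0..1}"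
    and nw: "\<not> (4/5 * ext (subs w t) r < ext (subs w (rev s)) r' \<and>
        1 - ext (subs w (rev s)) r' < 8/7 * (1 - ext (subs w t) r))"
    using pre_avoids[of s t w] assms(1) z s t by blast
  have "True \<in> set (subs w t)" "False \<in> set (subs w (rev s))"
    using s t set_subs[of t w] set_subs[of "rev s" w] by auto
  then have pos: "0 < ext (subs w t) r" "ext (subs w (rev s)) r' < 1"
    using r by (auto intro: ext_pos ext_less_1)
  have gap: "lex_gap 0 (subs w p) (subs w q)" if "lex_gap (length w) p q" for p q
    using lex_gap_subs[of 0 w p q] that by simp
  show "\<not> lex_gap (length w) t (rev s)"
  proof
    assume "lex_gap (length w) t (rev s)"
    then have "ext (subs w t) r \<le> ext (subs w (rev s)) r'"
      using r by (intro lex_gap_ext_le[OF gap]) auto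
    then have "4/5 * ext (subs w t) r < ext (subs w (rev s)) r' \<and>
        1 - ext (subs w (rev s)) r' < 8/7 * (1 - ext (subs w t) r)"
      using pos by (intro conjI; simp)
    then show False using nw by blast
  qed
  fix k l
  show "\<not> (lex_gap (length w) (pow_word [False, True] k) (rev s) \<and>
      lex_gap (length w) t ([False, True, True] @ pow_word [False, True] l))"
  proof
    assume *: "lex_gap (length w) (pow_word [False, True] k) (rev s) \<and>
      lex_gap (length w) t ([False, True, True] @ pow_word [False, True] l)"
    obtain y where y: "0 < y" "y < 1" "ext (subs w [False, True]) y = y"
      "4/5 * ext (subs w [False, True, True]) y \<le> y"
      "1 - y \<le> 8/7 * (1 - ext (subs w [False, True, True]) y)"
      using corner by blast
    \<comment> \<open>As \<open>y\<close> is fixed by the image of \<open>01\<close>, finitely many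
      periods followed by \<open>y\<close> have the value of the infinite periodic word.\<close>
    have yk: "ext (subs w (pow_word [False, True] k)) y = y" for k
      using y(3) by (simp add: subs_pow_word ext_pow_word)
    have "y < ext (subs w (rev s)) r'"
      using lex_gap_ext_less[OF gap y(2), of _ _ r'] * r yk by fastforce
    moreover have "ext (subs w t) r \<le> ext (subs w [False, True, True]) y"
      using lex_gap_ext_le[OF gap, of t "[False, True, True] @ pow_word [False, True] l" r y] * r y yk
      unfolding subs_append ext_append by auto
    ultimately have "4/5 * ext (subs w t) r < ext (subs w (rev s)) r' \<and>
        1 - ext (subs w (rev s)) r' < 8/7 * (1 - ext (subs w t) r)"
      using y(4,5) by (intro conjI; simp)
    then show False using nw by blast
  qed
qed

lemma pre_no_pair:
  assumes "z \<in> pre w" "no_pair (\<not> i) z"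
  shows "z \<in> {[], [\<not> i]} \<odot> sub i ` pre (w @ [i])"
proof -
  obtain p y where z: "z = p @ sub i y" "p \<in> {[], [\<not> i]}"
    using sub_if_no_pair[OF assms(2)] by blast
  then have "sub i y \<in> pre w" using assms(1) pre_factor[of p "sub i y" "[]"] by simp
  then have "y \<in> pre (w @ [i])" by (simp add: pre_def subs_snoc)
  then show ?thesis unfolding z(1) using z(2) by (intro wordcatI imageI)
qed

text \<open>Words of \<open>pre w\<close> are products of a fixed number of pieces, each of bounded
  length or, up to one letter, the image of a word one level deeper.\<close>

lemma summable_pre_step:
  assumes x: "0 < x" and IH: "\<And>i. weight x (w @ [i]) summable_on pre (w @ [i])"
  shows "weight x w summable_on pre w"
proof -
  define S where "S i = {[], [\<not> i]} \<odot> sub i ` pre (w @ [i])" for i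
  define M :: "bool list set" where "M = {z. length z \<le> length w}"
  \<comment> \<open>In order: leading 1s, left margin, the three words of
    \<open>good_decomp\<close>, right margin, trailing 0s.\<close>
  define R where "R = S True \<odot> M \<odot> S False \<odot> S True \<odot> S True \<odot> M \<odot> S False"
  have "finite M" unfolding M_def
    using finite_lists_length_le[of "UNIV :: bool set" "length w"] by simp
  have cat: "weight x w summable_on A \<odot> B"
    if "weight x w summable_on A" "weight x w summable_on B" for A B
    using that x by (intro summable_on_wordcat) (auto simp: weight_append weight_nonneg)
  have "weight x w summable_on S i" for i
  proof -
    have "(\<lambda>z. weight x w (sub i z)) summable_on pre (w @ [i])"
      using IH[of i] by (simp add: weight_def[abs_def] subs_snoc)
    then show ?thesis unfolding S_def by (intro cat summable_on_image_nonneg) auto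
  qed
  then have "weight x w summable_on R"
    unfolding R_def using \<open>finite M\<close> by (intro cat) (auto intro: summable_on_finite)
  moreover have "pre w \<subseteq> R"
  proof
    fix z assume z: "z \<in> pre w"
    \<comment> \<open>Removing the leading \<open>1\<close>s and the trailing \<open>0\<close>s excludes the exceptional cases \<open>Y = 1\<close> and \<open>X = 0\<close>.\<close>
    define a where "a = takeWhile id z"
    define z1 where "z1 = dropWhile id z"
    define b where "b = rev (takeWhile Not (rev z1))"
    define y where "y = rev (dropWhile Not (rev z1))"
    have z_eq: "z = a @ y @ b"
      unfolding a_def b_def y_def rev_append[symmetric] takeWhile_dropWhile_id rev_rev_ident z1_def ..
    have hd: "hd y = False \<and> last y = True" if "y \<noteq> []"
    proof
      have "hd (dropWhile Not (rev z1)) = True"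
        using hd_dropWhile[of Not "rev z1"] that by (auto simp: y_def)
      then show "last y = True" using that by (simp add: y_def last_rev)
      have "z1 = y @ b" unfolding b_def y_def rev_append[symmetric] takeWhile_dropWhile_id by simp
      then show "hd y = False" using hd_dropWhile[of id z] that by (auto simp: z1_def[symmetric])
    qed
    have "y \<in> pre w" "a \<in> pre w" "b \<in> pre w"
      using z pre_factor[of a y b w] pre_factor[of "[]" a "y @ b" w] pre_factor[of "a @ y" b "[]" w]
      by (auto simp: z_eq)
    have const: "no_pair x u" if "\<And>v. v \<in> set u \<Longrightarrow> v \<noteq> x" for x u
      using that by (induction u) (auto simp: successively_Cons)
    have a: "a \<in> S True"
      using pre_no_pair[of a w True] \<open>a \<in> pre w\<close> const[of a False] set_takeWhileD[of _ id z]
      unfolding S_def a_def by auto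
    have b: "b \<in> S False"
      using pre_no_pair[of b w False] \<open>b \<in> pre w\<close> const[of b True] set_takeWhileD[of _ Not "rev z1"]
      unfolding S_def b_def by auto
    \<comment> \<open>Empty factors fill the middle places of \<open>R\<close> when \<open>y\<close>
      is too short to be decomposed.\<close>
    have nil: "[] \<in> S i" for i
    proof -
      have "[] \<in> pre w" using z pre_factor[of "[]" "[]" z w] by simp
      then show ?thesis using pre_no_pair[of "[]" w i] by (simp add: S_def)
    qed
    define K where "K = length w"
    have "y \<in> M \<odot> S False \<odot> S True \<odot> S True \<odot> M"
    proof (cases "length y \<le> 2 * K")
      case True
      have "take K y \<in> M" "drop K y \<in> M" using True by (auto simp: M_def K_def)
      then have "take K y @ [] @ [] @ [] @ drop K y \<in> M \<odot> S False \<odot> S True \<odot> S True \<odot> M"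
        using nil by (intro wordcatI)
      then show ?thesis by simp
    next
      case False
      define m1 where "m1 = take K y"
      define m2 where "m2 = drop (length y - K) y"
      define u where "u = take (length y - 2 * K) (drop K y)"
      have y_eq: "y = m1 @ u @ m2"
      proof -
        have "m2 = drop (length y - 2 * K) (drop K y)"
          unfolding m2_def drop_drop using False by (intro arg_cong[of _ _ "\<lambda>k. drop k y"]) simp
        then show ?thesis unfolding m1_def u_def by (simp only: append_take_drop_id)
      qed
      have lens: "length m1 = K" "length m2 = K" using False by (auto simp: m1_def m2_def)
      have "good K (m1 @ u @ m2)"
        using pre_good[OF \<open>y \<in> pre w\<close>] hd False unfolding y_eq[symmetric] K_def by fastforce
      then obtain n0 n1 n2 where
        u: "u = n0 @ n1 @ n2" "no_pair True n0" "no_pair False n1" "no_pair False n2"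
        using good_decomp[of K m1 u m2] lens by (metis order_refl)
      have "n0 \<in> pre w" "n1 \<in> pre w" "n2 \<in> pre w"
        using \<open>y \<in> pre w\<close> pre_factor[of m1 n0 "n1 @ n2 @ m2" w]
          pre_factor[of "m1 @ n0" n1 "n2 @ m2" w] pre_factor[of "m1 @ n0 @ n1" n2 m2 w]
        by (auto simp: y_eq u(1))
      then have "n0 \<in> S False" "n1 \<in> S True" "n2 \<in> S True"
        using u pre_no_pair[of n0 w False] pre_no_pair[of n1 w True] pre_no_pair[of n2 w True]
        by (auto simp: S_def)
      moreover have "m1 \<in> M" "m2 \<in> M" using lens by (auto simp: M_def K_def)
      ultimately have "m1 @ n0 @ n1 @ n2 @ m2 \<in> M \<odot> S False \<odot> S True \<odot> S True \<odot> M"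
        by (intro wordcatI)
      then show ?thesis by (simp add: y_eq u(1))
    qed
    then obtain y1 y2 y3 y4 y5 where ys: "y = y1 @ y2 @ y3 @ y4 @ y5" "y1 \<in> M" "y2 \<in> S False"
      "y3 \<in> S True" "y4 \<in> S True" "y5 \<in> M"
      unfolding wordcat_def by auto
    then have "a @ y1 @ y2 @ y3 @ y4 @ y5 @ b \<in> R"
      unfolding R_def using ys a b by (intro wordcatI)
    then show "z \<in> R" using z_eq ys(1) by simp
  qed
  ultimately show ?thesis by (rule summable_on_subset_banach)
qed

text \<open>Induction on the number \<open>d\<close> of levels left until depth
  \<open>2 * n\<close>, where \<open>summable_weight_deep\<close> applies.\<close>

lemma summable_language:
  fixes x :: real
  assumes x: "0 < x" "x < 1"
  shows "(\<lambda>z. x ^ length z) summable_on L"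
proof -
  have "(\<lambda>n. x ^ n) \<longlonglongrightarrow> 0" using x LIMSEQ_realpow_zero[of x] by simp
  then have "\<forall>\<^sub>F n in sequentially. x ^ n < 1 - x"
    using x by (intro order_tendstoD) auto
  then obtain n where n: "x + x ^ n < 1"
    by (auto simp: eventually_sequentially algebra_simps)
  have "weight x w summable_on pre w" if "2 * n \<le> length w + d" for w d
    using that
  proof (induction d arbitrary: w)
    case 0
    then show ?case using summable_weight_deep[OF x n] by simp
  next
    case (Suc d)
    then have "2 * n \<le> length (w @ [i]) + d" for i by simp
    then show ?case by (rule summable_pre_step[OF x(1) Suc.IH])
  qed
  from this[of "[]" "2 * n"] show ?thesis by (simp add: weight_def[abs_def] pre_def)
qed

end

section \<open>Hausdorff dimension\<close>

abbreviation digits :: "(nat \<Rightarrow> bool) \<Rightarrow> real" where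
  "digits P \<equiv> (\<Sum>n. of_bool (P n) / 2 ^ (n + 1))"

lemma digits_ext: "digits P = ext (map P [0..<n]) (digits (\<lambda>i. P (i + n)))"
proof (induction n arbitrary: P)
  case (Suc n)
  have "digits P = (of_bool (P 0) + digits (\<lambda>i. P (Suc i))) / 2"
    using suminf_digits_split[of P] by (simp only: add_divide_distrib)
  also have "\<dots> = ext (map P [0..<Suc n]) (digits (\<lambda>i. P (i + Suc n)))"
    unfolding map_upt_Suc Suc[of "\<lambda>i. P (Suc i)"] by (simp del: upt_Suc)
  finally show ?case .
qed simp

lemma digits_in_unit: "digits P \<in> {0..1}"
  unfolding atLeastAtMost_iff by (intro conjI suminf_nonneg summable_digits suminf_digits_le) simp_all

section \<open>Finite windows of bi-infinite sequences\<close>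

definition window :: "(int \<Rightarrow> bool) \<Rightarrow> int \<Rightarrow> nat \<Rightarrow> bool list" where
  "window u k n = map (\<lambda>i. u (k + int i)) [0..<n]"

definition language :: "(int \<Rightarrow> bool) set \<Rightarrow> bool list set" where
  "language S = {window u k n | u k n. u \<in> S}"

lemma digits_close:
  assumes "\<And>i. i < n \<Longrightarrow> P i = Q i"
  shows "\<bar>digits P - digits Q\<bar> \<le> 1 / 2 ^ n"
proof -
  have "map P [0..<n] = map Q [0..<n]" using assms by simp
  then have "digits P - digits Q = (digits (\<lambda>i. P (i + n)) - digits (\<lambda>i. Q (i + n))) / 2 ^ n"
    by (simp only: digits_ext[of P n] digits_ext[of Q n] ext_diff length_map length_upt diff_zero)
  moreover have "\<bar>digits (\<lambda>i. P (i + n)) - digits (\<lambda>i. Q (i + n))\<bar> \<le> 1"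
    using digits_in_unit[of "\<lambda>i. P (i + n)"] digits_in_unit[of "\<lambda>i. Q (i + n)"]
    by (simp only: atLeastAtMost_iff abs_le_iff) linarith
  ultimately show ?thesis by (simp add: abs_divide divide_right_mono)
qed

text \<open>Positions \<open>1 - n\<close> to \<open>n\<close> carry exactly the first
  \<open>n\<close> digits of each coordinate.\<close>

lemma baker_pt_close:
  assumes "window u (1 - int n) (2 * n) = window v (1 - int n) (2 * n)"
  shows "norm (baker_pt u - baker_pt v) \<le> 2 / 2 ^ n"
proof -
  have eq: "u k = v k" if "1 - int n \<le> k" "k \<le> int n" for k
  proof -
    have "\<forall>i<2 * n. u (1 - int n + int i) = v (1 - int n + int i)"
      using assms unfolding window_def by simp
    moreover have "nat (k + int n - 1) < 2 * n" "1 - int n + int (nat (k + int n - 1)) = k"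
      using that by auto
    ultimately show ?thesis by metis
  qed
  have "norm (baker_pt u - baker_pt v) \<le>
      \<bar>digits (\<lambda>i. u (int i + 1)) - digits (\<lambda>i. v (int i + 1))\<bar> +
      \<bar>digits (\<lambda>i. u (- int i)) - digits (\<lambda>i. v (- int i))\<bar>"
    unfolding baker_pt_def diff_Pair real_norm_def[symmetric] by (rule norm_Pair_le)
  also have "\<dots> \<le> 1 / 2 ^ n + 1 / 2 ^ n"
    by (intro add_mono digits_close eq) auto
  finally show ?thesis by simp
qed

section \<open>Dimension zero from covers by cylinders\<close>

lemma hausdorff_dim_eq_0I:
  assumes "\<And>s. 0 < s \<Longrightarrow> hausdorff_measure s A = 0"
  shows "hausdorff_dim A = 0"
proof (rule antisym[OF ennreal_le_epsilon])
  fix e :: real assume "0 < e"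
  then show "hausdorff_dim A \<le> 0 + ennreal e"
    unfolding hausdorff_dim_def using assms by (intro Inf_lower2[of "ennreal e"]) auto
qed simp

lemma hausdorff_premeasure_finite_cover:
  assumes W: "finite W" and cover: "A \<subseteq> (\<Union>z\<in>W. U z)"
    and U: "\<And>z. z \<in> W \<Longrightarrow> bounded (U z) \<and> diameter (U z) \<le> d" and d: "0 < d" "d \<le> \<delta>" and s: "0 < s"
  shows "hausdorff_premeasure s \<delta> A \<le> ennreal (card W * d powr s)"
proof -
  obtain h where h: "bij_betw h {0..<card W} W"
    using ex_bij_betw_nat_finite[OF W] by blast
  \<comment> \<open>Padding by empty sets, which \<open>diam_pow\<close> counts as 0.\<close>
  define V where "V i = (if i < card W then U (h i) else {})" for i
  have hW: "h i \<in> W" if "i < card W" for i using h that by (auto simp: bij_betw_def)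
  have "delta_cover \<delta> A V"
    unfolding delta_cover_def
  proof (intro conjI allI)
    show "A \<subseteq> (\<Union>i. V i)"
    proof
      fix a assume "a \<in> A"
      then obtain z where z: "z \<in> W" "a \<in> U z" using cover by blast
      then have "z \<in> h ` {0..<card W}" using h by (simp add: bij_betw_def)
      then obtain i where "i < card W" "h i = z" by auto
      then show "a \<in> (\<Union>i. V i)" using z by (auto simp: V_def intro!: exI[of _ i])
    qed
    show "bounded (V i)" "diameter (V i) \<le> \<delta>" for i
      using U[OF hW, of i] d by (auto simp: V_def)
  qed
  then have "hausdorff_premeasure s \<delta> A \<le> (\<Sum>i. diam_pow s (V i))"
    unfolding hausdorff_premeasure_def by (intro INF_lower) simp
  also have "\<dots> = (\<Sum>i<card W. diam_pow s (V i))"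
    by (intro suminf_finite) (auto simp: V_def diam_pow_def)
  also have "\<dots> \<le> (\<Sum>i<card W. ennreal (d powr s))"
  proof (intro sum_mono)
    fix i assume "i \<in> {..<card W}"
    then have "bounded (V i)" "diameter (V i) \<le> d" using U[OF hW, of i] by (auto simp: V_def)
    then show "diam_pow s (V i) \<le> ennreal (d powr s)"
      using s by (auto simp: diam_pow_def intro!: ennreal_leI powr_mono2 diameter_ge_0)
  qed
  also have "\<dots> = ennreal (card W * d powr s)"
    by (simp add: ennreal_mult ennreal_of_nat_eq_real_of_nat)
  finally show ?thesis .
qed

lemma hausdorff_dim_baker_image:
  assumes sum: "\<And>x::real. 0 < x \<Longrightarrow> x < 1 \<Longrightarrow> (\<lambda>z. x ^ length z) summable_on language S"
  shows "hausdorff_dim (baker_pt ` S) = 0"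
proof (rule hausdorff_dim_eq_0I)
  fix s :: real assume s: "0 < s"
  \<comment> \<open>Then \<open>2 powr (- s * n)\<close> is \<open>x ^ (4 * n)\<close>: half of the
    exponent pays for the number of cylinders, the other half tends to 0.\<close>
  define x :: real where "x = 2 powr (- s / 4)"
  have x: "0 < x" "x < 1" using s by (auto simp: x_def powr_less_one)
  define C where "C = infsum (\<lambda>z. x ^ length z) (language S)"
  define W where "W n = (\<lambda>u. window u (1 - int n) (2 * n)) ` S" for n
  have finW: "finite (W n)" for n
    by (rule finite_subset[OF _ finite_lists_length_eq[of "UNIV :: bool set" "2 * n"]])
      (auto simp: W_def window_def)
  have card: "card (W n) * x ^ (2 * n) \<le> C" for n
  proof -
    have "(\<Sum>z\<in>W n. x ^ length z) \<le> C"
      unfolding C_def using x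
      by (intro finite_sum_le_infsum sum finW) (auto simp: W_def language_def)
    moreover have "(\<Sum>z\<in>W n. x ^ length z) = (\<Sum>z\<in>W n. x ^ (2 * n))"
      by (intro sum.cong) (auto simp: W_def window_def)
    ultimately show ?thesis by simp
  qed
  have bound: "card (W n) * (2 / 2 ^ n) powr s \<le> C * 2 powr s * (x ^ 2) ^ n" for n
  proof -
    have "(2 / 2 ^ n :: real) powr s = 2 powr s * 2 powr (- s * n)"
      by (simp add: powr_divide powr_minus_divide powr_powr powr_realpow[symmetric] mult.commute)
    also have "2 powr (- s * n) = x ^ (2 * n) * (x ^ 2) ^ n"
      by (simp add: x_def powr_realpow[symmetric] powr_powr powr_add[symmetric] flip: power_mult)
    finally have "card (W n) * (2 / 2 ^ n) powr s = (card (W n) * x ^ (2 * n)) * (2 powr s * (x ^ 2) ^ n)"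
      by simp
    also have "\<dots> \<le> C * (2 powr s * (x ^ 2) ^ n)"
      using card[of n] x by (intro mult_right_mono) auto
    finally show ?thesis by simp
  qed
  have "hausdorff_premeasure s \<delta> (baker_pt ` S) = 0" if \<delta>: "0 < \<delta>" for \<delta>
  proof -
    have "hausdorff_premeasure s \<delta> (baker_pt ` S) \<le> ennreal (C * 2 powr s * (x ^ 2) ^ n)"
      if n: "2 / 2 ^ n \<le> \<delta>" for n
    proof -
      define U where "U z = baker_pt ` {u \<in> S. window u (1 - int n) (2 * n) = z}" for z
      have "bounded (U z) \<and> diameter (U z) \<le> 2 / 2 ^ n" for z
      proof
        have "bounded unit_square" unfolding unit_square_def by (intro bounded_Times) auto
        then show "bounded (U z)"
          by (rule bounded_subset) (auto simp: U_def baker_pt_in_unit_square)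
        show "diameter (U z) \<le> 2 / 2 ^ n"
          by (rule diameter_le) (auto simp: U_def baker_pt_close)
      qed
      then have "hausdorff_premeasure s \<delta> (baker_pt ` S) \<le> ennreal (card (W n) * (2 / 2 ^ n) powr s)"
        using n s by (intro hausdorff_premeasure_finite_cover[OF finW, where U = U]) (auto simp: U_def W_def)
      also have "\<dots> \<le> ennreal (C * 2 powr s * (x ^ 2) ^ n)"
        using bound by (intro ennreal_leI) auto
      finally show ?thesis .
    qed
    moreover have "\<forall>\<^sub>F n in sequentially. 2 / 2 ^ n \<le> \<delta>"
    proof -
      have "(\<lambda>n. 2 * (1 / 2) ^ n) \<longlonglongrightarrow> 2 * (0::real)"
        by (intro tendsto_intros LIMSEQ_realpow_zero) auto
      then have "\<forall>\<^sub>F n in sequentially. 2 * (1 / 2) ^ n < \<delta>"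
        using \<delta> by (intro order_tendstoD) auto
      then show ?thesis by eventually_elim (simp add: power_one_over)
    qed
    ultimately have "\<forall>\<^sub>F n in sequentially.
        hausdorff_premeasure s \<delta> (baker_pt ` S) \<le> ennreal (C * 2 powr s * (x ^ 2) ^ n)"
      by (auto elim: eventually_mono)
    moreover have "(\<lambda>n. ennreal (C * 2 powr s * (x ^ 2) ^ n)) \<longlonglongrightarrow> ennreal (C * 2 powr s * 0)"
      using x by (intro tendsto_ennrealI tendsto_mult tendsto_const LIMSEQ_realpow_zero) (auto simp: power_less_one_iff)
    ultimately have "hausdorff_premeasure s \<delta> (baker_pt ` S) \<le> ennreal (C * 2 powr s * 0)"
      by (intro tendsto_lowerbound[of _ _ sequentially]) auto
    then show ?thesis by simp
  qed
  then show "hausdorff_measure s (baker_pt ` S) = 0"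
    unfolding hausdorff_measure_def by (simp add: SUP_constant) 
qed

section \<open>The two holes\<close>

text \<open>With the marked 1 at position 0, the first coordinate reads 0 and then \<open>t\<close>,
  the second reads 1 and then \<open>rev s\<close>.\<close>

lemma window_split:
  assumes "window u k n = s @ [True, False] @ t"
  obtains r r' where "r \<in> {0..1}" "r' \<in> {0..1}"
    "baker_pt (shift (k + int (length s)) u) = (ext t r / 2, (1 + ext (rev s) r') / 2)"
proof -
  define j where "j = k + int (length s)"
  have n: "n = length s + 2 + length t"
    using arg_cong[OF assms, of length] by (simp add: window_def)
  have nth: "u (k + int i) = (s @ [True, False] @ t) ! i" if "i < n" for i
    unfolding assms[symmetric] using that by (simp add: window_def)
  have 1: "map (\<lambda>i. shift j u (int i + 1)) [0..<Suc (length t)] = False # t"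
  proof (rule nth_equalityI)
    fix i assume "i < length (map (\<lambda>i. shift j u (int i + 1)) [0..<Suc (length t)])"
    then have i: "i \<le> length t" by simp
    have "shift j u (int i + 1) = u (k + int (length s + 1 + i))"
      by (simp add: shift_def j_def algebra_simps)
    also have "\<dots> = (False # t) ! i"
      using i by (subst nth) (auto simp: n nth_append)
    finally show "map (\<lambda>i. shift j u (int i + 1)) [0..<Suc (length t)] ! i = (False # t) ! i"
      using i by (simp del: upt_Suc)
  qed simp
  have 2: "map (\<lambda>i. shift j u (- int i)) [0..<Suc (length s)] = True # rev s"
  proof (rule nth_equalityI)
    fix i assume "i < length (map (\<lambda>i. shift j u (- int i)) [0..<Suc (length s)])"
    then have i: "i \<le> length s" by simp
    have "shift j u (- int i) = u (k + int (length s - i))"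
      using i by (simp add: shift_def j_def algebra_simps of_nat_diff)
    also have "\<dots> = (True # rev s) ! i"
      using i by (subst nth) (auto simp: n nth_append nth_Cons rev_nth split: nat.splits)
    finally show "map (\<lambda>i. shift j u (- int i)) [0..<Suc (length s)] ! i = (True # rev s) ! i"
      using i by (simp del: upt_Suc)
  qed simp
  show ?thesis
    by (rule that[OF digits_in_unit digits_in_unit],
        unfold baker_pt_def j_def[symmetric],
        subst digits_ext[of "\<lambda>i. shift j u (int i + 1)" "Suc (length t)"],
        subst digits_ext[of "\<lambda>i. shift j u (- int i)" "Suc (length s)"],
        unfold 1 2) simp
qed

lemma language_factor: "a @ z @ b \<in> language S \<Longrightarrow> z \<in> language S"
proof -
  assume "a @ z @ b \<in> language S"
  then obtain u k n where u: "u \<in> S" "a @ z @ b = window u k n"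
    unfolding language_def by blast
  have n: "n = length a + length z + length b"
    using arg_cong[OF u(2), of length] by (simp add: window_def)
  have "z = take (length z) (drop (length a) (window u k n))"
    unfolding u(2)[symmetric] by simp
  also have "\<dots> = window u (k + int (length a)) (length z)"
    by (rule nth_equalityI) (auto simp: window_def n algebra_simps)
  finally show ?thesis using u(1) unfolding language_def by blast
qed

definition survivors :: "(real \<times> real) set \<Rightarrow> (int \<Rightarrow> bool) set" where
  "survivors H = {u. \<forall>n. baker_pt (shift n u) \<notin> H}"

lemma language_survivors_avoids:
  assumes "s @ [True, False] @ t \<in> language (survivors H)"
  obtains r r' where "r \<in> {0..1}" "r' \<in> {0..1}" "(ext t r / 2, (1 + ext (rev s) r') / 2) \<notin> H"
proof -
  obtain u k n where u: "u \<in> survivors H" "window u k n = s @ [True, False] @ t"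
    using assms unfolding language_def by force
  show ?thesis
    using window_split[OF u(2)] u(1) that unfolding survivors_def by (metis (mono_tags, lifting) mem_Collect_eq)
qed

lemma dimension_trapI:
  assumes "open H" "H \<subseteq> unit_square"
    and "\<And>x::real. 0 < x \<Longrightarrow> x < 1 \<Longrightarrow> (\<lambda>z. x ^ length z) summable_on language (survivors H)"
  shows "dimension_trap H"
proof -
  have "survivor_set H = baker_pt ` survivors H"
    by (auto simp: survivor_set_def survivors_def)
  then show ?thesis
    unfolding dimension_trap_def using assms hausdorff_dim_baker_image by (simp add: open_subset)
qed

section \<open>The quadrilaterals described by inequalities\<close>

lemma interior_hull_subset_unit_square:
  assumes "V \<subseteq> unit_square"
  shows "interior (convex hull V) \<subseteq> unit_square"
proof -
  have "convex unit_square" unfolding unit_square_def by (intro convex_Times convex_real_interval)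
  then have "convex hull V \<subseteq> unit_square" using assms by (intro hull_minimal)
  then show ?thesis using interior_subset by blast
qed

lemma in_hull_triangle:
  fixes p :: "'a :: real_vector"
  assumes "p = a *\<^sub>R x + b *\<^sub>R y + c *\<^sub>R z" "0 \<le> a" "0 \<le> b" "0 \<le> c" "a + b + c = 1"
    and "{x, y, z} \<subseteq> V"
  shows "p \<in> convex hull V"
proof -
  have "p \<in> convex hull {x, y, z}" unfolding convex_hull_3 using assms by blast
  then show ?thesis using hull_mono[OF assms(6)] by blast
qed

text \<open>The open set \<open>R\<close> is cut along the diagonal from (0, 1) to (5/24, 2/3); on
  each triangle the witnesses are barycentric coordinates.\<close>

lemma interior_hull_first:
  fixes X Y :: real
  assumes "0 < X" "Y < 1" "4/5 * X < Y" "1 - Y < 8/7 * (1 - X)"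
  shows "(X / 2, (1 + Y) / 2) \<in> interior (convex hull {(0, 1/2), (5/24, 2/3), (1/2, 1), (0, 1)})"
    (is "_ \<in> interior (convex hull ?V)")
proof -
  define R where "R = {p :: real \<times> real. 0 < fst p \<and> snd p < 1 \<and> 1/2 + 4/5 * fst p < snd p \<and>
    1 - snd p < 8/7 * (1/2 - fst p)}"
  have "open R"
    unfolding R_def by (intro open_Collect_conj open_Collect_less continuous_intros)
  moreover have "R \<subseteq> convex hull ?V"
  proof
    fix p assume "p \<in> R"
    then obtain x y where p: "p = (x, y)" "0 < x" "y < 1" "1/2 + 4/5 * x < y" "1 - y < 8/7 * (1/2 - x)"
      unfolding R_def by (cases p) auto
    show "p \<in> convex hull ?V"
    proof (cases "y \<le> 1 - 8/5 * x")
      case True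
      show ?thesis
        by (rule in_hull_triangle[where x = "(0, 1/2)" and y = "(5/24, 2/3)" and z = "(0, 1)"
              and a = "2 - 2 * y - 16/5 * x" and b = "24/5 * x" and c = "2 * y - 1 - 8/5 * x"])
          (use p True in \<open>auto simp: field_simps\<close>)
    next
      case False
      show ?thesis
        by (rule in_hull_triangle[where x = "(5/24, 2/3)" and y = "(1/2, 1)" and z = "(0, 1)"
              and a = "3 * (1 - y)" and b = "2 * x - 5/4 * (1 - y)" and c = "1 - 2 * x - 7/4 * (1 - y)"])
          (use p False in \<open>auto simp: field_simps\<close>)
    qed
  qed
  moreover have "(X / 2, (1 + Y) / 2) \<in> R" using assms by (auto simp: R_def field_simps)
  ultimately show ?thesis using interior_maximal by blast
qed

text \<open>The map sending (X, Y) to (1 - Y, 1 - X) turns these inequalities into those of the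
  first hole, and the corner (2/3, 7/12) into (5/12, 1/3).\<close>

lemma interior_hull_second:
  fixes X Y :: real
  assumes "0 < X" "Y < 1" "7/8 * X < Y" "1 - Y < 5/4 * (1 - X)"
  shows "(X / 2, (1 + Y) / 2) \<in> interior (convex hull {(0, 1/2), (1/3, 19/24), (1/2, 1), (0, 1)})"
    (is "_ \<in> interior (convex hull ?V)")
proof -
  define R where "R = {p :: real \<times> real. 0 < fst p \<and> snd p < 1 \<and> 1/2 + 7/8 * fst p < snd p \<and>
    1 - snd p < 5/4 * (1/2 - fst p)}"
  have "open R"
    unfolding R_def by (intro open_Collect_conj open_Collect_less continuous_intros)
  moreover have "R \<subseteq> convex hull ?V"
  proof
    fix p assume "p \<in> R"
    then obtain x y where p: "p = (x, y)" "0 < x" "y < 1" "1/2 + 7/8 * x < y" "1 - y < 5/4 * (1/2 - x)"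
      unfolding R_def by (cases p) auto
    show "p \<in> convex hull ?V"
    proof (cases "y \<le> 1 - 5/8 * x")
      case True
      show ?thesis
        by (rule in_hull_triangle[where x = "(0, 1/2)" and y = "(1/3, 19/24)" and z = "(0, 1)"
              and a = "2 - 2 * y - 5/4 * x" and b = "3 * x" and c = "2 * y - 1 - 7/4 * x"])
          (use p True in \<open>auto simp: field_simps\<close>)
    next
      case False
      show ?thesis
        by (rule in_hull_triangle[where x = "(1/3, 19/24)" and y = "(1/2, 1)" and z = "(0, 1)"
              and a = "24/5 * (1 - y)" and b = "2 * x - 16/5 * (1 - y)" and c = "1 - 2 * x - 8/5 * (1 - y)"])
          (use p False in \<open>auto simp: field_simps\<close>)
    qed
  qed
  moreover have "(X / 2, (1 + Y) / 2) \<in> R" using assms by (auto simp: R_def field_simps)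
  ultimately show ?thesis using interior_maximal by blast
qed

lemma ext_map_Not: "ext (map Not p) r = 1 - ext p (1 - r)"
  by (induction p) (auto simp: field_simps of_bool_def)

theorem theorem3p7:
  shows "dimension_trap (interior (convex hull {(0, 1/2), (5/24, 2/3), (1/2, 1), (0, 1)}))
       \<and> dimension_trap (interior (convex hull {(0, 1/2), (1/3, 19/24), (1/2, 1), (0, 1)}))"
    (is "dimension_trap ?H1 \<and> dimension_trap ?H2")
proof (intro conjI dimension_trapI open_interior interior_hull_subset_unit_square)
  show "{(0, 1/2), (5/24, 2/3), (1/2, 1), (0, 1)} \<subseteq> unit_square"
    "{(0, 1/2), (1/3, 19/24), (1/2, 1), (0, 1)} \<subseteq> unit_square"
    by (auto simp: unit_square_def)
  fix x :: real assume x: "0 < x" "x < 1"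
  interpret L1: wedge_language "language (survivors ?H1)"
  proof
    fix s t assume st: "s @ [True, False] @ t \<in> language (survivors ?H1)" "False \<in> set s" "True \<in> set t"
    obtain r r' where r: "r \<in> {0..1}" "r' \<in> {0..1}" "(ext t r / 2, (1 + ext (rev s) r') / 2) \<notin> ?H1"
      using language_survivors_avoids[OF st(1)] by blast
    have "0 < ext t r" "ext (rev s) r' < 1" using st r by (auto intro: ext_pos ext_less_1)
    then show "\<exists>r\<in>{0..1}. \<exists>r'\<in>{0..1}. \<not> (4/5 * ext t r < ext (rev s) r' \<and>
        1 - ext (rev s) r' < 8/7 * (1 - ext t r))"
      using r interior_hull_first by blast
  qed (rule language_factor)
  show "(\<lambda>z. x ^ length z) summable_on language (survivors ?H1)"
    using x by (rule L1.summable_language)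
  \<comment> \<open>Reversing and complementing fixes \<open>10\<close> and exchanges its contexts,
    sending (X, Y) to (1 - Y, 1 - X).\<close>
  define g :: "bool list \<Rightarrow> bool list" where "g z = rev (map Not z)" for z
  have gg: "g (g z) = z" for z by (simp add: g_def rev_map o_def)
  interpret L2: wedge_language "g ` language (survivors ?H2)"
  proof
    fix a z b assume "a @ z @ b \<in> g ` language (survivors ?H2)"
    then have "g (a @ z @ b) \<in> language (survivors ?H2)" using gg by auto
    then have "g z \<in> language (survivors ?H2)"
      using language_factor[of "g b" "g z" "g a"] by (simp add: g_def)
    then show "z \<in> g ` language (survivors ?H2)" by (metis gg imageI)
  next
    fix s t
    assume st: "s @ [True, False] @ t \<in> g ` language (survivors ?H2)" "False \<in> set s" "True \<in> set t"
    then have "g (s @ [True, False] @ t) \<in> language (survivors ?H2)" using gg by auto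
    then have "g t @ [True, False] @ g s \<in> language (survivors ?H2)" by (simp add: g_def)
    then obtain r r' where r: "r \<in> {0..1}" "r' \<in> {0..1}"
      "(ext (g s) r / 2, (1 + ext (rev (g t)) r') / 2) \<notin> ?H2"
      by (rule language_survivors_avoids)
    have eq: "ext (g s) r = 1 - ext (rev s) (1 - r)" "ext (rev (g t)) r' = 1 - ext t (1 - r')"
      by (simp_all add: g_def ext_map_Not rev_map)
    have pos: "0 < ext t (1 - r')" "ext (rev s) (1 - r) < 1"
      using st r by (auto intro: ext_pos ext_less_1)
    have "\<not> (4/5 * ext t (1 - r') < ext (rev s) (1 - r) \<and>
        1 - ext (rev s) (1 - r) < 8/7 * (1 - ext t (1 - r')))"
      using r(3) interior_hull_second[of "1 - ext (rev s) (1 - r)" "1 - ext t (1 - r')"] pos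
      unfolding eq by auto
    then show "\<exists>r\<in>{0..1}. \<exists>r'\<in>{0..1}. \<not> (4/5 * ext t r < ext (rev s) r' \<and>
        1 - ext (rev s) r' < 8/7 * (1 - ext t r))"
      using r by (intro bexI[of _ "1 - r'"] bexI[of _ "1 - r"]) auto
  qed
  \<comment> \<open>\<open>g\<close> preserves length and is an involution, so summability carries
    back to the original language.\<close>
  have "(\<lambda>z. x ^ length (g z)) summable_on g ` language (survivors ?H2)"
    using L2.summable_language[OF x] by (simp add: g_def)
  then have "(\<lambda>z. x ^ length z) summable_on g ` g ` language (survivors ?H2)"
    by (rule summable_on_image_nonneg)
  then show "(\<lambda>z. x ^ length z) summable_on language (survivors ?H2)"
    by (simp add: image_image gg)
qed

end
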